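(* For all integers $n\ge 1$ and $k$, $$\mathfrak B_{2n}^{(k)}=\sum_{m=1}^n\sum_{l=1}^m(-1)^{n-m}4^{m-l}(2m)!\left\{ {n \atop m} \right\}_2\left\{ {m \atop l} \right\}_2\mathfrak C_{2l}^{(k)}.$$
   Context: The Stirling numbers of the second kind with level $2$, $\left\{ {n \atop k} \right\}_2$ ($n,k\ge0$), are defined by $\left\{ {n \atop k} \right\}_2=\left\{ {n-1 \atop k-1} \right\}_2+k^2\left\{ {n-1 \atop k} \right\}_2$ with $\left\{ {0 \atop 0} \right\}_2=1$ and $\left\{ {n \atop 0} \right\}_2=\left\{ {0 \atop n} \right\}_2=0$ for $n\ge1$. For an integer $k$, the poly-Bernoulli numbers with level $2$ are defined by $\sum_{n\ge0}\mathfrak B_n^{(k)}\frac{x^n}{n!}=\frac{{\rm Li}_{2,k}(2\sin(x/2))}{2\sin(x/2)}$ with ${\rm Li}_{2,k}(z)=\sum_{n\ge0}\frac{z^{2n+1}}{(2n+1)^k}$, and the poly-Cauchy numbers with level $2$ are defined by $\sum_{n\ge0}\mathfrak C_n^{(k)}\frac{x^n}{n!}={\rm Lif}_{2,k}({\rm arcsinh}\,x)$ with ${\rm Lif}_{2,k}(z)=\sum_{m\ge0}\frac{z^{2m}}{(2m)!(2m+1)^k}$ (as power series). *)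

theory Defs
  imports Complex_Main "HOL-Computational_Algebra.Formal_Power_Series"
begin

fun stirling2_lev2 :: "nat \<Rightarrow> nat \<Rightarrow> nat" where
  "stirling2_lev2 0 0 = 1"
| "stirling2_lev2 (Suc n) 0 = 0"
| "stirling2_lev2 0 (Suc k) = 0"
| "stirling2_lev2 (Suc n) (Suc k) =
     stirling2_lev2 n k + (Suc k)\<^sup>2 * stirling2_lev2 n (Suc k)"

(* sum over n of z^(2n+1) / (2n+1)^k, with j = 2n+1 *)
definition Li2_fps :: "int \<Rightarrow> real fps" where
  "Li2_fps k = Abs_fps (\<lambda>j. if odd j then 1 / real j powi k else 0)"

(* sum over m of z^(2m) / ((2m)! (2m+1)^k), with j = 2m *)
definition Lif2_fps :: "int \<Rightarrow> real fps" where
  "Lif2_fps k = Abs_fps (\<lambda>j. if even j then 1 / (fact j * real (j + 1) powi k) else 0)"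

(* fps_sin c is the series of sin (c x), so this is 2 sin (x/2) *)
definition two_sin_half_fps :: "real fps" where
  "two_sin_half_fps = fps_const 2 * fps_sin (1 / 2)"

definition sinh_fps :: "real fps" where
  "sinh_fps = fps_const (1 / 2) * (fps_exp 1 - fps_exp (-1))"

definition arsinh_fps :: "real fps" where
  "arsinh_fps = fps_inv sinh_fps"

(* The quotient is an exact one in the power series ring, as poly_bernoulli2_exact
   below shows: numerator and denominator both have subdegree 1. *)
definition poly_bernoulli2 :: "int \<Rightarrow> nat \<Rightarrow> real" where
  "poly_bernoulli2 k n =
     fact n * fps_nth ((Li2_fps k oo two_sin_half_fps) / two_sin_half_fps) n"

definition poly_cauchy2 :: "int \<Rightarrow> nat \<Rightarrow> real" where
  "poly_cauchy2 k n = fact n * fps_nth (Lif2_fps k oo arsinh_fps) n"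

lemma two_sin_half_fps_nth_0: "fps_nth two_sin_half_fps 0 = 0"
  by (simp add: two_sin_half_fps_def)

lemma two_sin_half_fps_nth_1: "fps_nth two_sin_half_fps (Suc 0) = 1"
  by (simp add: two_sin_half_fps_def fps_sin_def)

lemma poly_bernoulli2_egf:
  "Abs_fps (\<lambda>n. poly_bernoulli2 k n / fact n) =
     (Li2_fps k oo two_sin_half_fps) / two_sin_half_fps"
  by (simp add: fps_eq_iff poly_bernoulli2_def)

lemma poly_bernoulli2_exact:
  "Abs_fps (\<lambda>n. poly_bernoulli2 k n / fact n) * two_sin_half_fps =
     Li2_fps k oo two_sin_half_fps"
proof -
  have s1: "fps_nth two_sin_half_fps 1 \<noteq> 0"
    using two_sin_half_fps_nth_1 by simp
  then have nz: "two_sin_half_fps \<noteq> 0"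
    by auto
  have le: "subdegree two_sin_half_fps \<le> 1"
    using s1 by (rule subdegree_leI)
  have "two_sin_half_fps dvd (Li2_fps k oo two_sin_half_fps)"
  proof (cases "Li2_fps k oo two_sin_half_fps = 0")
    case False
    have "fps_nth (Li2_fps k oo two_sin_half_fps) 0 = 0"
      by (simp add: Li2_fps_def)
    then have "1 \<le> subdegree (Li2_fps k oo two_sin_half_fps)"
      using False by (intro subdegree_geI) auto
    then show ?thesis
      using False nz le by (simp add: fps_dvd_iff)
  qed simp
  then show ?thesis
    by (simp add: poly_bernoulli2_egf)
qed

lemma poly_cauchy2_egf:
  "Abs_fps (\<lambda>n. poly_cauchy2 k n / fact n) = Lif2_fps k oo arsinh_fps"
  by (simp add: fps_eq_iff poly_cauchy2_def)

lemma arsinh_fps_compose: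
  "arsinh_fps oo sinh_fps = fps_X" "sinh_fps oo arsinh_fps = fps_X"
proof -
  have s: "fps_nth sinh_fps 0 = 0" "fps_nth sinh_fps 1 \<noteq> 0"
    by (simp_all add: sinh_fps_def)
  show "arsinh_fps oo sinh_fps = fps_X"
    unfolding arsinh_fps_def using s by (rule fps_inv)
  show "sinh_fps oo arsinh_fps = fps_X"
    unfolding arsinh_fps_def using s by (rule fps_inv_right)
qed

end

theory Submission
  imports Defs
begin

text \<open>
  If a power series \<open>f\<close> without constant term satisfies \<open>f'' = a f\<close> and \<open>f'\<^sup>2 = 1 + a f\<^sup>2\<close>, then
  \<open>(f\<^sup>2\<^sup>m)'' = 2m(2m - 1) f\<^sup>2\<^sup>m\<^sup>-\<^sup>2 + 4am\<^sup>2 f\<^sup>2\<^sup>m\<close>, which is, up to powers of \<open>4a\<close>, the recurrence of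
  the Stirling numbers of level 2 for the even coefficients of \<open>f\<^sup>2\<^sup>m / (2m)!\<close>. With
  \<open>f = 2 sin (x/2)\<close> and \<open>a = -1/4\<close> this expands the poly-Bernoulli numbers in terms of the
  \<open>1 / (2m + 1)\<^sup>k\<close>; with \<open>f = sinh x\<close> and \<open>a = 1\<close>, substituting \<open>sinh\<close> into the generating function
  of the poly-Cauchy numbers expresses each \<open>1 / (2m + 1)\<^sup>k\<close> in terms of those numbers.
\<close>

section \<open>Level-2 Stirling numbers in the even powers of a series\<close>

lemma stirling2_lev2_eq_0: "n < m \<Longrightarrow> stirling2_lev2 n m = 0"
  by (induction n m rule: stirling2_lev2.induct) auto

lemma stirling2_lev2_0_right: "stirling2_lev2 n 0 = (if n = 0 then 1 else 0)"
  by (cases n) auto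

lemma fps_deriv2_power_Suc_Suc:
  fixes f :: "'a::comm_ring_1 fps"
  shows "fps_deriv (fps_deriv (f ^ Suc (Suc j))) =
    of_nat (Suc (Suc j)) * of_nat (Suc j) * f ^ j * (fps_deriv f)\<^sup>2
      + of_nat (Suc (Suc j)) * f ^ Suc j * fps_deriv (fps_deriv f)"
proof -
  have d: "fps_deriv (f ^ Suc i) = of_nat (Suc i) * f ^ i * fps_deriv f" for i
    using fps_deriv_power'[of f "Suc i"] by (simp add: mult_ac)
  show ?thesis
    unfolding d by (simp only: fps_deriv_mult d fps_deriv_of_nat)
      (simp only: power2_eq_square mult_zero_left add_0_left add_0_right mult_ac distrib_left add_ac)
qed

lemma fps_deriv2_even_power:
  fixes f :: "real fps"
  assumes "fps_deriv (fps_deriv f) = fps_const a * f"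
    and "(fps_deriv f)\<^sup>2 = 1 + fps_const a * f\<^sup>2"
  shows "fps_deriv (fps_deriv (f ^ (2 * Suc m))) =
    fps_const (real (2 * m + 2) * real (2 * m + 1)) * f ^ (2 * m)
      + fps_const (4 * a * (real (Suc m))\<^sup>2) * f ^ (2 * Suc m)"
proof -
  have "fps_deriv (fps_deriv (f ^ (2 * Suc m))) =
      of_nat (2 * m + 2) * of_nat (2 * m + 1) * f ^ (2 * m) * (1 + fps_const a * f\<^sup>2)
        + of_nat (2 * m + 2) * f ^ (2 * m + 1) * (fps_const a * f)"
    using fps_deriv2_power_Suc_Suc[where f = f and j = "2 * m"] assms by simp
  \<comment> \<open>The terms carrying \<open>a\<close> merge: (2m+2)(2m+1) + (2m+2) = (2m+2)^2 =
    4(m+1)^2.\<close>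
  also have "\<dots> = of_nat (2 * m + 2) * of_nat (2 * m + 1) * f ^ (2 * m)
      + fps_const a * (of_nat (2 * m + 2) * of_nat (2 * m + 2)) * f ^ (2 * Suc m)"
    by (simp add: algebra_simps power2_eq_square)
  also have "\<dots> = fps_const (real (2 * m + 2)) * fps_const (real (2 * m + 1)) * f ^ (2 * m)
      + fps_const a * (fps_const (real (2 * m + 2)) * fps_const (real (2 * m + 2)))
        * f ^ (2 * Suc m)"
    by (simp only: fps_of_nat)
  also have "\<dots> = fps_const (real (2 * m + 2) * real (2 * m + 1)) * f ^ (2 * m)
      + fps_const (a * (real (2 * m + 2) * real (2 * m + 2))) * f ^ (2 * Suc m)"
    by (simp only: fps_const_mult)
  also have "a * (real (2 * m + 2) * real (2 * m + 2)) = 4 * a * (real (Suc m))\<^sup>2"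
    by (simp add: power2_eq_square algebra_simps)
  finally show ?thesis .
qed

text \<open>Two derivatives lower \<open>n\<close> by one and relate the power \<open>2 * m\<close>
  to itself and to the power two below, matching the two terms of the Stirling recurrence; hence
  \<open>m\<close> stays arbitrary in the induction. For \<open>n = 0\<close>, the vanishing
  constant term of \<open>f\<close> leaves only \<open>m = 0\<close>.\<close>

lemma fps_nth_even_power:
  fixes f :: "real fps"
  assumes "fps_nth f 0 = 0"
    and "fps_deriv (fps_deriv f) = fps_const a * f"
    and "(fps_deriv f)\<^sup>2 = 1 + fps_const a * f\<^sup>2"
  shows "fact (2 * n) * fps_nth (f ^ (2 * m)) (2 * n) =
    (4 * a) ^ (n - m) * fact (2 * m) * real (stirling2_lev2 n m)"
proof (induction n arbitrary: m)
  case 0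
  then show ?case
    using assms(1) by (cases m) simp_all
next
  case (Suc n)
  show ?case
  proof (cases m)
    case 0
    then show ?thesis by simp
  next
    case (Suc m')
    have "fact (2 * Suc n) * fps_nth (f ^ (2 * Suc m')) (2 * Suc n) =
        fact (2 * n) * fps_nth (fps_deriv (fps_deriv (f ^ (2 * Suc m')))) (2 * n)"
      by (simp del: power_Suc)
    also have "\<dots> = real (2 * m' + 2) * real (2 * m' + 1)
          * (fact (2 * n) * fps_nth (f ^ (2 * m')) (2 * n))
        + 4 * a * (real (Suc m'))\<^sup>2 * (fact (2 * n) * fps_nth (f ^ (2 * Suc m')) (2 * n))"
      unfolding fps_deriv2_even_power[OF assms(2,3)]
        fps_add_nth fps_mult_left_const_nth by (simp only: algebra_simps)
    also have "\<dots> = (4 * a) ^ (n - m') * fact (2 * Suc m') * real (stirling2_lev2 n m')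
        + 4 * a * (4 * a) ^ (n - Suc m') * fact (2 * Suc m')
          * ((real (Suc m'))\<^sup>2 * real (stirling2_lev2 n (Suc m')))"
    proof -
      have *: "fact (2 * Suc m') = real (2 * m' + 2) * real (2 * m' + 1) * fact (2 * m')"
        by (simp add: algebra_simps)
      show ?thesis
        unfolding Suc.IH * by (simp only: mult_ac)
    qed
    also have "4 * a * (4 * a) ^ (n - Suc m') * fact (2 * Suc m')
          * ((real (Suc m'))\<^sup>2 * real (stirling2_lev2 n (Suc m'))) =
        (4 * a) ^ (n - m') * fact (2 * Suc m')
          * ((real (Suc m'))\<^sup>2 * real (stirling2_lev2 n (Suc m')))"
    \<comment> \<open>For \<open>m' < n\<close> the extra factor \<open>4 * a\<close> raises the
      exponent by one. Otherwise both truncated exponents are 0, but the Stirling number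
      vanishes.\<close>
    proof (cases "m' < n")
      case True
      then have "n - m' = Suc (n - Suc m')" by simp
      then show ?thesis by simp
    qed (simp add: stirling2_lev2_eq_0)
    finally show ?thesis
      by (simp only: Suc stirling2_lev2.simps diff_Suc_Suc of_nat_add of_nat_mult of_nat_power
          distrib_left mult.assoc)
  qed
qed

section \<open>Parity of powers and of summation indices\<close>

lemma odd_fps_power_nth_eq_0:
  fixes f :: "'a::comm_ring_1 fps"
  assumes "\<And>j. even j \<Longrightarrow> fps_nth f j = 0" and "even i \<noteq> even n"
  shows "fps_nth (f ^ i) n = 0"
  using assms(2)
proof (induction i arbitrary: n)
  case 0
  then show ?case by (auto intro: odd_pos)
next
  case (Suc i)
  \<comment> \<open>For even \<open>j\<close> the first factor vanishes; for odd \<open>j\<close>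
    the parities of \<open>i\<close> and \<open>n - j\<close> still differ, so the second does by
    induction.\<close>
  have "fps_nth f j * fps_nth (f ^ i) (n - j) = 0" if "j \<le> n" for j
    using assms(1)[of j] Suc that by (cases "even j") auto
  then show ?case
    by (simp add: fps_mult_nth)
qed

lemma sum_atMost_double_even:
  fixes g :: "nat \<Rightarrow> 'a::comm_monoid_add"
  assumes "\<And>i. odd i \<Longrightarrow> g i = 0"
  shows "(\<Sum>i = 0..2 * n. g i) = (\<Sum>m = 0..n. g (2 * m))"
  using assms by (induction n) simp_all

section \<open>The series 2 sin (x/2) and sinh x\<close>

lemma two_sin_half_nth_even_power:
  "fact (2 * n) * fps_nth (two_sin_half_fps ^ (2 * m)) (2 * n) =
    (-1) ^ (n - m) * fact (2 * m) * real (stirling2_lev2 n m)"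
proof -
  have d1: "fps_deriv two_sin_half_fps = fps_cos (1/2)"
    by (simp add: two_sin_half_fps_def fps_sin_deriv mult.assoc[symmetric])
  have d2: "fps_deriv (fps_deriv two_sin_half_fps) = fps_const (-1/4) * two_sin_half_fps"
    unfolding d1 by (simp add: two_sin_half_fps_def fps_cos_deriv mult.assoc[symmetric])
  have "(fps_cos (1/2) :: real fps)\<^sup>2 = 1 - (fps_sin (1/2))\<^sup>2"
    using fps_sin_cos_sum_of_squares[of "1/2 :: real"] by (simp add: algebra_simps)
  moreover have "fps_const (-1/4) * two_sin_half_fps\<^sup>2 = - (fps_sin (1/2))\<^sup>2"
    by (simp add: two_sin_half_fps_def power_mult_distrib fps_const_power mult.assoc[symmetric]
        flip: fps_const_neg)
  ultimately have "(fps_deriv two_sin_half_fps)\<^sup>2 = 1 + fps_const (-1/4) * two_sin_half_fps\<^sup>2"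
    unfolding d1 by simp
  from fps_nth_even_power[OF two_sin_half_fps_nth_0 d2 this] show ?thesis
    by simp
qed

lemma sinh_nth_even_power:
  "fact (2 * n) * fps_nth (sinh_fps ^ (2 * m)) (2 * n) =
    4 ^ (n - m) * fact (2 * m) * real (stirling2_lev2 n m)"
proof -
  \<comment> \<open>The series of cosh x.\<close>
  define c :: "real fps" where "c = fps_const (1/2) * (fps_exp 1 + fps_exp (-1))"
  have d1: "fps_deriv sinh_fps = c"
    by (simp add: sinh_fps_def c_def flip: fps_const_neg)
  have d2: "fps_deriv (fps_deriv sinh_fps) = fps_const 1 * sinh_fps"
    unfolding d1 by (simp add: sinh_fps_def c_def flip: fps_const_neg)
  have "c\<^sup>2 - sinh_fps\<^sup>2 =
      (fps_const (1/2))\<^sup>2 * ((fps_exp 1 + fps_exp (-1))\<^sup>2 - (fps_exp 1 - fps_exp (-1))\<^sup>2)"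
    unfolding c_def sinh_fps_def power_mult_distrib by (simp only: right_diff_distrib)
  also have "\<dots> = fps_const 1 * (fps_exp 1 * fps_exp (-1))"
  proof -
    have "(x + y)\<^sup>2 - (x - y)\<^sup>2 = 4 * (x * y)" for x y :: "real fps"
      by (simp add: power2_eq_square algebra_simps)
    moreover have "(fps_const (1/2))\<^sup>2 * 4 = (1 :: real fps)"
      by (simp add: numeral_fps_const power2_eq_square)
    ultimately show ?thesis by (simp only: mult.assoc[symmetric] fps_const_1_eq_1)
  qed
  also have "\<dots> = 1"
    by (simp flip: fps_exp_add_mult)
  finally have "(fps_deriv sinh_fps)\<^sup>2 = 1 + fps_const 1 * sinh_fps\<^sup>2"
    unfolding d1 by (simp add: algebra_simps)
  moreover have "fps_nth sinh_fps 0 = 0"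
    by (simp add: sinh_fps_def)
  ultimately show ?thesis
    using fps_nth_even_power[OF _ d2] by simp
qed

section \<open>Poly-Bernoulli and poly-Cauchy numbers\<close>

lemma poly_bernoulli2_even:
  "poly_bernoulli2 k (2 * n) =
    (\<Sum>m = 0..n. (-1) ^ (n - m) * fact (2 * m) * real (stirling2_lev2 n m)
      / real (2 * m + 1) powi k)"
proof -
  let ?s = two_sin_half_fps
  \<comment> \<open>This is \<open>Li2_fps k\<close> divided by its argument, so
    \<open>g oo ?s\<close> is exactly the quotient in the generating function.\<close>
  define g :: "real fps" where
    "g = Abs_fps (\<lambda>j. if even j then 1 / real (j + 1) powi k else 0)"
  have "Li2_fps k = fps_X * g"
    by (auto simp: fps_eq_iff Li2_fps_def g_def)
  then have "Li2_fps k oo ?s = (g oo ?s) * ?s"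
    by (simp add: fps_compose_mult_distrib two_sin_half_fps_nth_0 mult.commute)
  moreover have "?s \<noteq> 0"
    using two_sin_half_fps_nth_1 by auto
  ultimately have "poly_bernoulli2 k (2 * n) = fact (2 * n) * fps_nth (g oo ?s) (2 * n)"
    by (simp add: poly_bernoulli2_def)
  also have "\<dots> = fact (2 * n) *
      (\<Sum>m = 0..n. fps_nth g (2 * m) * fps_nth (?s ^ (2 * m)) (2 * n))"
    \<comment> \<open>Only even powers of \<open>?s\<close> remain because the outer series
      \<open>g\<close> is even.\<close>
    unfolding fps_compose_nth by (subst sum_atMost_double_even) (simp_all add: g_def)
  also have "\<dots> = (\<Sum>m = 0..n. fps_nth g (2 * m) *
      (fact (2 * n) * fps_nth (?s ^ (2 * m)) (2 * n)))"
    by (simp add: sum_distrib_left mult_ac)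
  also have "\<dots> = (\<Sum>m = 0..n. (-1) ^ (n - m) * fact (2 * m) * real (stirling2_lev2 n m)
      / real (2 * m + 1) powi k)"
    by (simp only: two_sin_half_nth_even_power) (simp add: g_def)
  finally show ?thesis .
qed

lemma sum_stirling2_lev2_poly_cauchy2:
  "(\<Sum>l = 0..m. 4 ^ (m - l) * real (stirling2_lev2 m l) * poly_cauchy2 k (2 * l)) =
    1 / real (2 * m + 1) powi k"
proof -
  define C where "C = Lif2_fps k oo arsinh_fps"
  \<comment> \<open>Here the odd-indexed terms of the composition drop out through the inner series:
    odd powers of the odd series sinh have no coefficients in even degree.\<close>
  have odd_sinh: "fps_nth (sinh_fps ^ i) (2 * m) = 0" if "odd i" for i
    using that by (intro odd_fps_power_nth_eq_0) (simp_all add: sinh_fps_def)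
  have "C oo sinh_fps = Lif2_fps k oo (arsinh_fps oo sinh_fps)"
    unfolding C_def by (rule fps_compose_assoc[symmetric])
      (simp_all add: sinh_fps_def arsinh_fps_def fps_inv_def)
  then have "Lif2_fps k = C oo sinh_fps"
    by (simp add: arsinh_fps_compose)
  moreover have "fact (2 * m) * fps_nth (Lif2_fps k) (2 * m) = 1 / real (2 * m + 1) powi k"
    by (simp add: Lif2_fps_def)
  ultimately have "1 / real (2 * m + 1) powi k = fact (2 * m) * fps_nth (C oo sinh_fps) (2 * m)"
    by simp
  also have "\<dots> = fact (2 * m) *
      (\<Sum>l = 0..m. fps_nth C (2 * l) * fps_nth (sinh_fps ^ (2 * l)) (2 * m))"
    unfolding fps_compose_nth by (subst sum_atMost_double_even) (simp_all add: odd_sinh)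
  also have "\<dots> = (\<Sum>l = 0..m. fps_nth C (2 * l) *
      (fact (2 * m) * fps_nth (sinh_fps ^ (2 * l)) (2 * m)))"
    by (simp add: sum_distrib_left mult_ac)
  also have "\<dots> = (\<Sum>l = 0..m. 4 ^ (m - l) * real (stirling2_lev2 m l) * poly_cauchy2 k (2 * l))"
    by (simp only: sinh_nth_even_power) (simp add: C_def poly_cauchy2_def mult_ac)
  finally show ?thesis by simp
qed

theorem theorem8:
  fixes n :: nat and k :: int
  assumes "n \<ge> 1"
  shows "poly_bernoulli2 k (2 * n) =
    (\<Sum>m = 1..n. \<Sum>l = 1..m.
       (-1) ^ (n - m) * 4 ^ (m - l) * fact (2 * m) *
       real (stirling2_lev2 n m) * real (stirling2_lev2 m l) * poly_cauchy2 k (2 * l))"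
proof -
  \<comment> \<open>The sums can start at 1: the term \<open>l = 0\<close> vanishes for
    \<open>m \<ge> 1\<close>, and below the term \<open>m = 0\<close> vanishes for
    \<open>n \<ge> 1\<close>.\<close>
  have cauchy: "1 / real (2 * m + 1) powi k =
      (\<Sum>l = 1..m. 4 ^ (m - l) * real (stirling2_lev2 m l) * poly_cauchy2 k (2 * l))"
    if "m \<ge> 1" for m
    using that sum_stirling2_lev2_poly_cauchy2[of m k]
    by (simp add: sum.atLeast_Suc_atMost[of 0 m] stirling2_lev2_0_right)
  have "poly_bernoulli2 k (2 * n) =
      (\<Sum>m = 1..n. (-1) ^ (n - m) * fact (2 * m) * real (stirling2_lev2 n m)
        * (1 / real (2 * m + 1) powi k))"
    using assms unfolding poly_bernoulli2_even
    by (simp add: sum.atLeast_Suc_atMost[of 0 n] stirling2_lev2_0_right)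
  also have "\<dots> = (\<Sum>m = 1..n. (-1) ^ (n - m) * fact (2 * m) * real (stirling2_lev2 n m)
      * (\<Sum>l = 1..m. 4 ^ (m - l) * real (stirling2_lev2 m l) * poly_cauchy2 k (2 * l)))"
    by (intro sum.cong refl arg_cong2[where f = "(*)"] cauchy) simp
  finally show ?thesis
    by (simp add: sum_distrib_left mult_ac)
qed

end
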